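(* Let $w_1$ be a binary word starting with $0$ and having at least $3$ runs. A circular permutation $[\tau]$ is contained in $[G(w_1)]$ if and only if $[\tau] = [G(w_2)]$ for some binary word $w_2$ starting with $0$ such that $w_2$ or its complement $w_2^c$ is a subsequence of $w_1$.
   Context: A run of a binary word is a maximal block of consecutive equal letters; the complement $w^c$ of a binary word swaps all $0$s and $1$s; subsequences need not be contiguous. For a binary word $w=w_1\cdots w_n$ starting with $0$ with at least $3$ runs, $G(w)$ is the permutation of $[n]$ with exactly one descent such that, for each $i$, $w_i=0$ iff the value $n-i+1$ appears after the descent; if $w$ starts with $0$ and has at most $2$ runs, $G(w)=12\cdots n$. A circular permutation $[\pi]$ is the set of all rotations of $\pi$; $[\sigma]$ contains $[\pi]$ if some rotation of $\sigma$ has a subsequence order-isomorphic to $\pi$. *)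

theory Defs
  imports "HOL-Library.Z2" "HOL-Library.Sublist" "HOL-Combinatorics.Multiset_Permutations"
begin

text \<open>
  Binary words are lists over \<^typ>\<open>bit\<close>.  Permutations of $[n]$ are in one-line notation, i.e. they are
  the elements of \<open>permutations_of_set {1..n}\<close>.  List positions are counted from 0.
\<close>

text \<open>The block of the letters at positions \<open>i, \<dots>, j - 1\<close> is a maximal block of equal letters.\<close>

definition is_run :: "'a list \<Rightarrow> nat \<Rightarrow> nat \<Rightarrow> bool" where
  "is_run w i j \<longleftrightarrow> i < j \<and> j \<le> length w \<and>
     (\<forall>k\<in>{i..<j}. w ! k = w ! i) \<and>
     (i = 0 \<or> w ! (i - 1) \<noteq> w ! i) \<and>
     (j = length w \<or> w ! j \<noteq> w ! i)"

definition num_runs :: "'a list \<Rightarrow> nat" where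
  "num_runs w = card {(i, j). is_run w i j}"

definition compl_word :: "bit list \<Rightarrow> bit list" where
  "compl_word w = map (\<lambda>b. if b = 0 then 1 else 0) w"

text \<open>\<open>d \<in> descents p\<close> means that there is a descent between \<open>p ! d\<close> and \<open>p ! Suc d\<close>, so that the values
  appearing after this descent are those in \<open>drop (Suc d) p\<close>.\<close>

definition descents :: "nat list \<Rightarrow> nat set" where
  "descents p = {d. Suc d < length p \<and> p ! d > p ! Suc d}"

definition is_G :: "bit list \<Rightarrow> nat list \<Rightarrow> bool" where
  "is_G w p \<longleftrightarrow> p \<in> permutations_of_set {1..length w} \<and>
     (\<exists>d. descents p = {d} \<and>
        (\<forall>i\<in>{1..length w}. w ! (i - 1) = 0 \<longleftrightarrow> length w - i + 1 \<in> set (drop (Suc d) p)))"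

text \<open>Only meaningful for words starting with 0; see \<open>is_G_ex1\<close> below for well-definedness.\<close>

definition G :: "bit list \<Rightarrow> nat list" where
  "G w = (if num_runs w \<ge> 3 then (THE p. is_G w p) else [1..<Suc (length w)])"

definition order_isomorphic :: "nat list \<Rightarrow> nat list \<Rightarrow> bool" where
  "order_isomorphic s p \<longleftrightarrow> length s = length p \<and>
     (\<forall>i<length p. \<forall>j<length p. s ! i < s ! j \<longleftrightarrow> p ! i < p ! j)"

definition circ :: "'a list \<Rightarrow> 'a list set" where
  "circ p = {rotate k p | k. True}"

text \<open>Containment of circular permutations, given by representatives; it depends only on
  \<open>circ \<sigma>\<close> and \<open>circ \<pi>\<close>, see \<open>circ_contains_cong\<close> below.\<close>

definition circ_contains :: "nat list \<Rightarrow> nat list \<Rightarrow> bool" where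
  "circ_contains \<sigma> \<pi> \<longleftrightarrow> (\<exists>\<rho>\<in>circ \<sigma>. \<exists>s. subseq s \<rho> \<and> order_isomorphic s \<pi>)"


subsection \<open>Well-definedness\<close>

lemma num_runs_ge_3_imp:
  fixes w :: "bit list"
  assumes "num_runs w \<ge> 3" and h0: "hd w = 0"
  shows "\<exists>i j. i < j \<and> j < length w \<and> w ! i = 1 \<and> w ! j = 0"
proof (rule ccontr)
  assume "\<not> ?thesis"
  hence no: "\<And>i j. i < j \<Longrightarrow> j < length w \<Longrightarrow> w ! i = 1 \<Longrightarrow> w ! j = 1"
    using bit_not_one_iff by blast
  define a where "a = length (takeWhile (\<lambda>b. b = 0) w)"
  have a_le: "a \<le> length w"
    unfolding a_def by (rule length_takeWhile_le)
  have lo: "w ! k = 0" if "k < a" for k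
  proof -
    have "takeWhile (\<lambda>b. b = 0) w ! k \<in> set (takeWhile (\<lambda>b. b = 0) w)"
      using that unfolding a_def by (rule nth_mem)
    thus ?thesis
      using that by (auto simp: a_def takeWhile_nth dest: set_takeWhileD)
  qed
  have hi: "w ! k = 1" if "a \<le> k" "k < length w" for k
  proof -
    have "w ! a \<noteq> 0"
      using nth_length_takeWhile[of "\<lambda>b. b = 0" w] that unfolding a_def by linarith
    hence "w ! a = 1"
      by simp
    thus ?thesis
      using that no[of a k] by (cases "k = a") auto
  qed
  have "(i, j) \<in> {(0, a), (a, length w)}" if r: "is_run w i j" for i j
  proof -
    have ij: "i < j" "j \<le> length w"
      and eq: "\<And>k. i \<le> k \<Longrightarrow> k < j \<Longrightarrow> w ! k = w ! i"
      and st: "i = 0 \<or> w ! (i - 1) \<noteq> w ! i"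
      and en: "j = length w \<or> w ! j \<noteq> w ! i"
      using r unfolding is_run_def atLeastLessThan_iff Ball_def by blast+
    show ?thesis
    proof (cases "i < a")
      case True
      have wi: "w ! i = 0"
        using lo[OF True] .
      have "i = 0"
        using st wi lo[of "i - 1"] True by auto
      moreover have "\<not> a < j"
        using eq[of a] wi hi[of a] True ij by auto
      moreover have "\<not> j < a"
        using en wi lo[of j] a_le by auto
      ultimately show ?thesis by auto
    next
      case False
      have wi: "w ! i = 1"
        using hi[of i] False ij by auto
      have "i = a"
      proof (rule ccontr)
        assume "i \<noteq> a"
        hence "w ! (i - 1) = 1" "i \<noteq> 0"
          using False ij hi[of "i - 1"] by auto
        thus False
          using st wi by simp
      qed
      moreover have "j = length w"
      proof (rule ccontr)
        assume "j \<noteq> length w"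
        hence "w ! j = 1"
          using hi[of j] ij False by linarith
        thus False
          using en wi \<open>j \<noteq> length w\<close> by simp
      qed
      ultimately show ?thesis by auto
    qed
  qed
  hence "{(i, j). is_run w i j} \<subseteq> {(0, a), (a, length w)}"
    by auto
  from card_mono[OF _ this] have "num_runs w \<le> card {(0, a), (a, length w)}"
    unfolding num_runs_def by simp
  also have "\<dots> \<le> 2"
    by (simp add: card_insert_if)
  finally show False using assms by simp
qed

lemma is_G_unique_aux:
  assumes p: "is_G w p"
  shows "p = sorted_list_of_set {v\<in>{1..length w}. w ! (length w - v) = 1} @
             sorted_list_of_set {v\<in>{1..length w}. w ! (length w - v) = 0}"
proof -
  let ?n = "length w"
  let ?A = "{v\<in>{1..length w}. w ! (length w - v) = 1}"
  let ?B = "{v\<in>{1..length w}. w ! (length w - v) = 0}"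
  from p obtain d where perm: "set p = {1..?n}" "distinct p" and d: "descents p = {d}"
    and w: "\<And>i. i \<in> {1..?n} \<Longrightarrow> w ! (i - 1) = 0 \<longleftrightarrow> ?n - i + 1 \<in> set (drop (Suc d) p)"
    by (auto simp: is_G_def permutations_of_set_def)
  have dl: "Suc d < length p"
    using d by (auto simp: descents_def)
  have asc: "p ! i \<le> p ! Suc i" if "Suc i < length p" "i \<noteq> d" for i
    using that d by (force simp: descents_def)
  have s1: "sorted (take (Suc d) p)"
    using asc dl by (auto simp: sorted_iff_nth_Suc)
  have s2: "sorted (drop (Suc d) p)"
    using asc dl by (auto simp: sorted_iff_nth_Suc)
  have B: "set (drop (Suc d) p) = ?B"
  proof -
    have "v \<in> set (drop (Suc d) p) \<longleftrightarrow> w ! (?n - v) = 0" if "v \<in> {1..?n}" for v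
      using w[of "?n - v + 1"] that by auto
    moreover have "set (drop (Suc d) p) \<subseteq> {1..?n}"
      using set_drop_subset[of "Suc d" p] perm(1) by simp
    ultimately show ?thesis by blast
  qed
  have un: "set (take (Suc d) p) \<union> set (drop (Suc d) p) = {1..?n}"
    by (metis append_take_drop_id perm(1) set_append)
  have dj: "set (take (Suc d) p) \<inter> set (drop (Suc d) p) = {}"
    using perm(2) by (metis append_take_drop_id distinct_append)
  have A: "set (take (Suc d) p) = ?A"
  proof -
    have "set (take (Suc d) p) = {1..?n} - ?B"
      using un dj B by blast
    also have "\<dots> = ?A"
      using bit_not_zero_iff by blast
    finally show ?thesis .
  qed
  have "take (Suc d) p = sorted_list_of_set ?A"
    by (rule sorted_distinct_set_unique) (use s1 perm A in auto)
  moreover have "drop (Suc d) p = sorted_list_of_set ?B"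
    by (rule sorted_distinct_set_unique) (use s2 perm B in auto)
  ultimately show ?thesis
    by (metis append_take_drop_id)
qed

lemma descents_append_sorted:
  assumes "sorted as" "sorted bs" "x \<in> set as" "y \<in> set bs" "y < x"
  shows "\<exists>d. Suc d = length as \<and> descents (as @ bs) = {d}"
proof -
  have ne: "as \<noteq> []" "bs \<noteq> []"
    using assms by auto
  obtain d where sd: "length as = Suc d"
    using ne by (cases as) auto
  obtain k where k: "k < length as" "as ! k = x"
    using assms(3) by (metis in_set_conv_nth)
  obtain l where l: "l < length bs" "bs ! l = y"
    using assms(4) by (metis in_set_conv_nth)
  have "as ! k \<le> as ! d"
    by (rule sorted_nth_mono[OF assms(1)]) (use k sd in auto)
  moreover have "bs ! 0 \<le> bs ! l"
    by (rule sorted_nth_mono[OF assms(2)]) (use l in auto)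
  ultimately have desc: "bs ! 0 < as ! d"
    using assms(5) k l by linarith
  have "e \<in> descents (as @ bs) \<longleftrightarrow> e = d" for e
  proof (cases e d rule: linorder_cases)
    case less
    have "as ! e \<le> as ! Suc e"
      by (rule sorted_nth_mono[OF assms(1)]) (use less sd in auto)
    thus ?thesis
      using less sd by (simp add: descents_def nth_append)
  next
    case equal
    thus ?thesis
      using desc sd ne by (simp add: descents_def nth_append)
  next
    case greater
    have "\<not> (as @ bs) ! e > (as @ bs) ! Suc e" if "Suc e < length (as @ bs)"
    proof -
      have "bs ! (e - Suc d) \<le> bs ! (e - d)"
        by (rule sorted_nth_mono[OF assms(2)]) (use greater sd that in auto)
      thus ?thesis
        using greater sd by (simp add: nth_append)
    qed
    thus ?thesis
      using greater by (auto simp: descents_def)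
  qed
  hence "descents (as @ bs) = {d}"
    by blast
  thus ?thesis
    using sd by auto
qed

lemma is_G_exists_aux:
  fixes w :: "bit list"
  assumes "num_runs w \<ge> 3" "hd w = 0"
  shows "is_G w (sorted_list_of_set {v\<in>{1..length w}. w ! (length w - v) = 1} @
                 sorted_list_of_set {v\<in>{1..length w}. w ! (length w - v) = 0})"
proof -
  let ?n = "length w"
  let ?A = "{v\<in>{1..length w}. w ! (length w - v) = 1}"
  let ?B = "{v\<in>{1..length w}. w ! (length w - v) = 0}"
  define a where "a = sorted_list_of_set ?A"
  define b where "b = sorted_list_of_set ?B"
  have a: "set a = ?A" "sorted a" "distinct a" and b: "set b = ?B" "sorted b" "distinct b"
    by (simp_all add: a_def b_def)
  obtain i j where ij: "i < j" "j < ?n" "w ! i = 1" "w ! j = 0"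
    using num_runs_ge_3_imp[OF assms] by blast
  have "?n - i \<in> set a" "?n - j \<in> set b" "?n - j < ?n - i"
    using ij by (auto simp: a b)
  then obtain d where sd: "Suc d = length a" and "descents (a @ b) = {d}"
    using descents_append_sorted[OF a(2) b(2)] by blast
  note desc = this(2)
  have dr: "drop (Suc d) (a @ b) = b"
    using sd by simp
  have perm: "a @ b \<in> permutations_of_set {1..?n}"
  proof -
    have "set a \<union> set b = {1..?n}"
      unfolding a(1) b(1) using bit_not_zero_iff by blast
    moreover have "set a \<inter> set b = {}"
      unfolding a(1) b(1) by auto
    ultimately show ?thesis
      using a(3) b(3) by (simp add: permutations_of_set_def)
  qed
  have "w ! (i - 1) = 0 \<longleftrightarrow> ?n - i + 1 \<in> set (drop (Suc d) (a @ b))" if "i \<in> {1..?n}" for i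
  proof -
    have "?n - (?n - i + 1) = i - 1"
      using that by auto
    thus ?thesis
      unfolding dr using that by (auto simp: b)
  qed
  hence "is_G w (a @ b)"
    unfolding is_G_def by (intro conjI perm exI[of _ d] desc ballI)
  thus ?thesis
    unfolding a_def b_def .
qed

lemma is_G_ex1:
  assumes "num_runs w \<ge> 3" "hd w = 0"
  shows "\<exists>!p. is_G w p"
  by (rule ex1I, rule is_G_exists_aux[OF assms], rule is_G_unique_aux)

lemma self_in_circ: "p \<in> circ p"
  unfolding circ_def by (rule CollectI, rule exI[of _ 0]) simp

lemma circ_contains_rotate_right:
  assumes "circ_contains \<sigma> \<pi>"
  shows "circ_contains \<sigma> (rotate m \<pi>)"
proof (induction m)
  case 0
  show ?case using assms by simp
next
  case (Suc m)
  then obtain k s where s: "subseq s (rotate k \<sigma>)" "order_isomorphic s (rotate m \<pi>)"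
    by (auto simp: circ_contains_def circ_def)
  have iso: "order_isomorphic (rotate1 s) (rotate (Suc m) \<pi>)"
  proof -
    have len: "length s = length \<pi>" and
      ord: "\<And>i j. i < length \<pi> \<Longrightarrow> j < length \<pi> \<Longrightarrow>
             s ! i < s ! j \<longleftrightarrow> rotate m \<pi> ! i < rotate m \<pi> ! j"
      using s(2) by (auto simp: order_isomorphic_def)
    have "rotate1 s ! i < rotate1 s ! j \<longleftrightarrow> rotate (Suc m) \<pi> ! i < rotate (Suc m) \<pi> ! j"
      if "i < length \<pi>" "j < length \<pi>" for i j
    proof -
      have "Suc i mod length \<pi> < length \<pi>" "Suc j mod length \<pi> < length \<pi>"
        using that by (auto intro!: mod_less_divisor)
      from ord[OF this] show ?thesis
        using that len by (simp add: nth_rotate1)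
    qed
    thus ?thesis
      using len by (simp add: order_isomorphic_def)
  qed
  have "\<exists>k'. subseq (rotate1 s) (rotate k' \<sigma>)"
  proof (cases s)
    case (Cons x xs)
    then obtain us vs where uv: "rotate k \<sigma> = us @ x # vs" "subseq xs vs"
      using list_emb_ConsD[of "(=)" x xs "rotate k \<sigma>"] s(1) by blast
    have "rotate (Suc (length us) + k) \<sigma> = rotate (length (us @ [x])) ((us @ [x]) @ vs)"
      using uv(1) rotate_rotate[of "Suc (length us)" k \<sigma>] by simp
    also have "\<dots> = vs @ us @ [x]"
      by (simp only: rotate_append)
    also have "subseq (xs @ [x]) (vs @ us @ [x])"
      by (intro list_emb_append_mono uv(2) list_emb_append2 subseq_order.refl)
    finally have "subseq (xs @ [x]) (rotate (Suc (length us) + k) \<sigma>)" .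
    moreover have "rotate1 s = xs @ [x]"
      using Cons by simp
    ultimately show ?thesis by metis
  qed simp
  with iso show ?case
    by (auto simp: circ_contains_def circ_def)
qed

lemma circ_contains_cong:
  assumes "circ \<sigma> = circ \<sigma>'" "circ \<pi> = circ \<pi>'"
  shows "circ_contains \<sigma> \<pi> \<longleftrightarrow> circ_contains \<sigma>' \<pi>'"
proof -
  have "circ_contains \<sigma> \<pi>2" if "circ_contains \<sigma> \<pi>1" "circ \<pi>1 = circ \<pi>2" for \<pi>1 \<pi>2
  proof -
    have "\<pi>2 \<in> circ \<pi>1"
      using that(2) self_in_circ[of \<pi>2] by simp
    thus ?thesis
      using circ_contains_rotate_right[OF that(1)] by (auto simp: circ_def)
  qed
  hence "circ_contains \<sigma> \<pi> \<longleftrightarrow> circ_contains \<sigma> \<pi>'"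
    using assms(2) by metis
  also have "\<dots> \<longleftrightarrow> circ_contains \<sigma>' \<pi>'"
    using assms(1) by (simp add: circ_contains_def)
  finally show ?thesis .
qed

end

theory Submission
  imports Defs
begin

text \<open>
  Write \<open>G w\<close> as the increasing list of the values of the ones of \<open>w\<close> followed by that of the values of
  the zeros.  This formula also covers words with at most two runs, and complementing the word merely
  swaps the two lists, that is, rotates the permutation.  A pattern of a rotation of \<open>G w\<^sub>1\<close> can
  be rotated to a pattern of \<open>G w\<^sub>1\<close> itself, and choosing entries of \<open>G w\<^sub>1\<close> is the same as choosing
  letters of \<open>w\<^sub>1\<close>.
\<close>

section \<open>The values carried by the letters of a word\<close>

definition letter_values :: "bit \<Rightarrow> bit list \<Rightarrow> nat list" where
  "letter_values b w = filter (\<lambda>v. w ! (length w - v) = b) [1..<Suc (length w)]"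

definition word_perm :: "bit list \<Rightarrow> nat list" where
  "word_perm w = letter_values 1 w @ letter_values 0 w"

lemma letter_values_Nil [simp]: "letter_values b [] = []"
  by (simp add: letter_values_def)

text \<open>The letter at position \<open>length w - v\<close> carries the value \<open>v\<close>,
  so the first letter carries the largest one. Prepending a letter therefore shifts no other value
  and only adds a new maximum at the end of one list; the inductions over words below rest on
  this.\<close>

lemma letter_values_Cons:
  "letter_values b (c # w) = letter_values b w @ (if c = b then [Suc (length w)] else [])"
proof -
  have "filter (\<lambda>v. (c # w) ! (Suc (length w) - v) = b) [1..<Suc (length w)]
      = filter (\<lambda>v. w ! (length w - v) = b) [1..<Suc (length w)]"
    by (rule filter_cong) (auto simp: Suc_diff_le)
  thus ?thesis
    by (auto simp: letter_values_def)
qed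

lemma set_letter_values: "set (letter_values b w) = {v\<in>{1..length w}. w ! (length w - v) = b}"
  by (auto simp: letter_values_def)

lemma sorted_letter_values: "sorted (letter_values b w)"
  unfolding letter_values_def by (intro sorted_wrt_filter sorted_upt)

lemma distinct_letter_values: "distinct (letter_values b w)"
  by (simp add: letter_values_def)

text \<open>In type \<open>bit\<close>, adding 1 swaps the two letters.\<close>

lemma letter_values_compl: "letter_values b (compl_word w) = letter_values (b + 1) w"
  by (induction w; cases b) (auto simp: letter_values_Cons compl_word_def)

lemma word_perm_in_permutations: "word_perm w \<in> permutations_of_set {1..length w}"
proof -
  have "set (letter_values 1 w) \<union> set (letter_values 0 w) = {1..length w}"
    unfolding set_letter_values using bit_not_zero_iff by blast
  moreover have "set (letter_values 1 w) \<inter> set (letter_values 0 w) = {}"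
    by (auto simp: set_letter_values)
  ultimately show ?thesis
    by (simp add: word_perm_def permutations_of_set_def distinct_letter_values)
qed

section \<open>Runs, and the closed formula for \<open>G\<close>\<close>

lemma ex_is_run:
  assumes "k < length w"
  shows "\<exists>i j. is_run w i j \<and> i \<le> k \<and> k < j"
proof -
  \<comment> \<open>The run around \<open>k\<close> is found by going left and right as far as the
    letter stays the same: \<open>P\<close> describes its possible starts, \<open>Q\<close> its
    possible ends, and the least of each is taken.\<close>
  define P where "P = (\<lambda>i. i \<le> k \<and> (\<forall>l\<in>{i..k}. w ! l = w ! k))"
  define Q where "Q = (\<lambda>j. k < j \<and> (j = length w \<or> w ! j \<noteq> w ! k))"
  define i where "i = Least P"
  define j where "j = Least Q"
  have "P k" and "Q (length w)"
    using assms by (auto simp: P_def Q_def)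
  hence "P i" and "Q j" and j_le: "j \<le> length w"
    unfolding i_def j_def by (auto intro: LeastI Least_le)
  hence i: "i \<le> k" "\<And>l. i \<le> l \<Longrightarrow> l \<le> k \<Longrightarrow> w ! l = w ! k"
    and j: "k < j" "j = length w \<or> w ! j \<noteq> w ! k"
    unfolding P_def Q_def Ball_def atLeastAtMost_iff by blast+
  have const: "w ! l = w ! k" if "i \<le> l" "l < j" for l
  proof (cases "l \<le> k")
    case False
    hence "\<not> Q l"
      using not_less_Least[of l Q] that unfolding j_def by blast
    thus ?thesis
      using False that j_le by (auto simp: Q_def)
  qed (use i(2) that in blast)
  have left: "w ! (i - 1) \<noteq> w ! i" if "i \<noteq> 0"
  proof
    assume eq: "w ! (i - 1) = w ! i"
    have "w ! l = w ! k" if "i - 1 \<le> l" "l \<le> k" for l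
    proof (cases "l = i - 1")
      case True
      thus ?thesis using eq i(2)[of i] i(1) by simp
    next
      case False
      with that show ?thesis by (intro i(2)) auto
    qed
    hence "P (i - 1)"
      unfolding P_def Ball_def atLeastAtMost_iff using i(1) by (meson diff_le_self le_trans)
    thus False
      using not_less_Least[of "i - 1" P] \<open>i \<noteq> 0\<close> unfolding i_def[symmetric] by simp
  qed
  have ij: "i < j"
    using i(1) j(1) by simp
  have "is_run w i j"
    unfolding is_run_def Ball_def atLeastLessThan_iff const[OF le_refl ij]
  proof (intro conjI allI impI)
    show "i = 0 \<or> w ! (i - 1) \<noteq> w ! k"
      using left const[OF le_refl ij] by metis
  qed (use ij j_le j(2) const in blast)+
  thus ?thesis using i(1) j(1) by blast
qed

text \<open>Positions 0, \<open>i\<close>, \<open>j\<close> carry the letters 0, 1, 0. Their runs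
  are pairwise distinct: a run containing both 0 and \<open>j\<close> would also contain
  \<open>i\<close>. This is the converse of \<open>num_runs_ge_3_imp\<close>.\<close>

lemma num_runs_ge_3:
  fixes w :: "bit list"
  assumes "hd w = 0" and ij: "i < j" "j < length w" "w ! i = 1" "w ! j = 0"
  shows "num_runs w \<ge> 3"
proof -
  have w0: "w ! 0 = 0"
    using assms by (metis hd_conv_nth length_0_conv not_less_zero)
  obtain a a' where a: "is_run w a a'" "a \<le> 0" "0 < a'"
    using ex_is_run[of 0 w] ij by (metis less_nat_zero_code gr0I)
  obtain b b' where b: "is_run w b b'" "b \<le> i" "i < b'"
    using ex_is_run[of i w] ij by (meson less_trans)
  obtain c c' where c: "is_run w c c'" "c \<le> j" "j < c'"
    using ex_is_run[of j w] ij by meson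
  have const: "w ! k = w ! l" if "is_run w d d'" "d \<le> k" "k < d'" "d \<le> l" "l < d'" for d d' k l
    using that unfolding is_run_def by (metis atLeastLessThan_iff)
  have "(a, a') \<noteq> (b, b')"
    using const[OF b(1), of 0 i] a b w0 ij by auto
  moreover have "(b, b') \<noteq> (c, c')"
    using const[OF b(1), of i j] b c ij by auto
  moreover have "(a, a') \<noteq> (c, c')"
    using const[OF a(1), of 0 i] a c w0 ij by auto
  ultimately have "card {(a, a'), (b, b'), (c, c')} = 3"
    by (simp del: prod.inject)
  moreover have "finite {(i, j). is_run w i j}"
  proof (rule finite_subset)
    have "i < length w \<and> j \<le> length w" if "is_run w i j" for i j
      using that unfolding is_run_def by linarith
    thus "{(i, j). is_run w i j} \<subseteq> {..<length w} \<times> {..length w}"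
      by blast
  qed simp
  moreover have "{(a, a'), (b, b'), (c, c')} \<subseteq> {(i, j). is_run w i j}"
    using a b c by auto
  ultimately show ?thesis
    unfolding num_runs_def by (metis card_mono)
qed

lemma G_eq_word_perm:
  assumes "hd w = 0"
  shows "G w = word_perm w"
proof (cases "num_runs w \<ge> 3")
  case True
  have eq: "sorted_list_of_set {v\<in>{1..length w}. w ! (length w - v) = b} = letter_values b w" for b
    by (rule sorted_distinct_set_unique)
      (simp_all add: sorted_letter_values distinct_letter_values set_letter_values)
  have "p = word_perm w" if "is_G w p" for p
    using is_G_unique_aux[OF that] by (simp only: eq word_perm_def)
  moreover have "is_G w (word_perm w)"
    using is_G_exists_aux[OF True assms] by (simp only: eq word_perm_def)
  ultimately have "(THE p. is_G w p) = word_perm w"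
    by (intro the_equality)
  thus ?thesis
    using True by (simp add: G_def)
next
  case False
  \<comment> \<open>Larger values sit further left, so \<open>u > v\<close> would put a 1 before a
    0. As \<open>w\<close> starts with 0, that would give three runs.\<close>
  have "u \<le> v" if "u \<in> set (letter_values 1 w)" "v \<in> set (letter_values 0 w)" for u v
  proof (rule ccontr)
    assume "\<not> u \<le> v"
    moreover have "u \<le> length w" "w ! (length w - u) = 1" "1 \<le> v" "w ! (length w - v) = 0"
      using that by (auto simp: set_letter_values)
    ultimately show False
      using num_runs_ge_3[OF assms, of "length w - u" "length w - v"] False by linarith
  qed
  hence "sorted (word_perm w)"
    by (auto simp: word_perm_def sorted_append sorted_letter_values)
  hence "word_perm w = [1..<Suc (length w)]"
  proof (rule sorted_distinct_set_unique)
    show "distinct (word_perm w)" "set (word_perm w) = set [1..<Suc (length w)]"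
      using word_perm_in_permutations[of w]
      by (simp_all add: permutations_of_set_def atLeastLessThanSuc_atLeastAtMost del: upt_Suc)
  qed (simp_all only: sorted_upt distinct_upt)
  thus ?thesis
    using False by (simp add: G_def)
qed

section \<open>Rotations and order isomorphism\<close>

lemma circ_append_commute: "circ (u @ v) = circ (v @ u)"
proof -
  have "circ (y @ x) \<subseteq> circ (x @ y)" for x y :: "'a list"
  proof
    fix p assume "p \<in> circ (y @ x)"
    then obtain k where "p = rotate k (y @ x)"
      by (auto simp: circ_def)
    also have "y @ x = rotate (length x) (x @ y)"
      by (simp add: rotate_append)
    finally show "p \<in> circ (x @ y)"
      by (auto simp: circ_def rotate_rotate)
  qed
  thus ?thesis by blast
qed

lemma circ_rotate: "circ (rotate k p) = circ p"
  by (metis append_take_drop_id circ_append_commute rotate_drop_take)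

lemma circ_word_perm_compl: "circ (word_perm (compl_word w)) = circ (word_perm w)"
  by (simp add: word_perm_def letter_values_compl circ_append_commute)

lemma order_isomorphic_rotate:
  assumes "order_isomorphic s p"
  shows "order_isomorphic (rotate m s) (rotate m p)"
proof (cases "p = []")
  case False
  hence "(m + i) mod length p < length p" for i
    by simp
  thus ?thesis
    using assms by (auto simp: order_isomorphic_def nth_rotate)
qed (use assms in \<open>auto simp: order_isomorphic_def\<close>)

lemma order_isomorphic_map:
  assumes "strict_mono_on (set p) f"
  shows "order_isomorphic (map f p) p"
  using assms by (auto simp: order_isomorphic_def strict_mono_on_less)

lemma order_isomorphic_trans:
  "order_isomorphic p q \<Longrightarrow> order_isomorphic q r \<Longrightarrow> order_isomorphic p r"
  by (simp add: order_isomorphic_def)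

lemma order_isomorphic_sym: "order_isomorphic p q \<Longrightarrow> order_isomorphic q p"
  by (simp add: order_isomorphic_def)

text \<open>Each entry is determined by its rank. Counting positions rather than values makes the
  rank depend only on comparisons between entries, which order isomorphism preserves.\<close>

lemma nth_permutation_conv_card:
  assumes "p \<in> permutations_of_set {1..k}" "i < length p"
  shows "p ! i = Suc (card {j\<in>{..<length p}. p ! j < p ! i})"
proof -
  have p: "set p = {1..k}" "distinct p"
    using assms(1) by (auto simp: permutations_of_set_def)
  have "(!) p ` {j\<in>{..<length p}. p ! j < p ! i} = {v \<in> set p. v < p ! i}"
    by (auto simp: set_conv_nth)
  also have "\<dots> = {1..<p ! i}"
    using nth_mem[OF assms(2)] p(1) by auto
  finally have "card {1..<p ! i} = card ((!) p ` {j\<in>{..<length p}. p ! j < p ! i})"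
    by simp
  also have "\<dots> = card {j\<in>{..<length p}. p ! j < p ! i}"
    by (intro card_image inj_onI) (use p(2) in \<open>auto simp: nth_eq_iff_index_eq\<close>)
  finally show ?thesis
    using nth_mem[OF assms(2)] p(1) by auto
qed

lemma order_isomorphic_permutations_eq:
  assumes "order_isomorphic p q" "p \<in> permutations_of_set {1..k}" "q \<in> permutations_of_set {1..l}"
  shows "p = q"
proof (rule nth_equalityI)
  show len: "length p = length q"
    using assms(1) by (simp add: order_isomorphic_def)
  fix i assume i: "i < length p"
  hence "{j\<in>{..<length p}. p ! j < p ! i} = {j\<in>{..<length q}. q ! j < q ! i}"
    using assms(1) by (auto simp: order_isomorphic_def)
  thus "p ! i = q ! i"
    using nth_permutation_conv_card[OF assms(2), of i] nth_permutation_conv_card[OF assms(3), of i]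
      i len by simp
qed

section \<open>Subsequences of words and patterns of permutations\<close>

lemma strict_mono_on_extend:
  fixes f :: "nat \<Rightarrow> nat"
  assumes "strict_mono_on {1..m} f" "f ` {1..m} \<subseteq> {1..n}"
  shows "strict_mono_on {1..Suc m} (f(Suc m := Suc n))"
    and "f(Suc m := Suc n) ` {1..Suc m} \<subseteq> {1..Suc n}"
  using assms unfolding strict_mono_on_def image_subset_iff by (auto simp: le_Suc_eq less_Suc_eq_le)

lemma map_letter_values_upd:
  "map (f(Suc (length w) := x)) (letter_values b w) = map f (letter_values b w)"
  by (auto simp: set_letter_values)

text \<open>Here \<open>f\<close> sends the value of a letter of \<open>w2\<close> to that of its
  partner in \<open>w1\<close>. Skipping a letter of \<open>w1\<close> keeps \<open>f\<close>;
  matching the two first letters extends it from maximum to maximum. A single \<open>f\<close>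
  serves both letters, so comparisons between the two lists are preserved as well.\<close>

lemma letter_values_subseq:
  assumes "subseq w2 w1"
  shows "\<exists>f. strict_mono_on {1..length w2} f \<and> f ` {1..length w2} \<subseteq> {1..length w1} \<and>
           (\<forall>b. subseq (map f (letter_values b w2)) (letter_values b w1))"
  using assms
proof (induction rule: list_emb.induct)
  case (list_emb_Nil ys)
  show ?case by (auto intro: strict_mono_onI)
next
  case (list_emb_Cons xs ys y)
  then obtain f where f: "strict_mono_on {1..length xs} f" "f ` {1..length xs} \<subseteq> {1..length ys}"
      "\<And>b. subseq (map f (letter_values b xs)) (letter_values b ys)" by blast
  show ?case
    by (rule exI[of _ f]) (use f in \<open>force simp: letter_values_Cons\<close>)
next
  case (list_emb_Cons2 x y xs ys)
  then obtain f where f: "strict_mono_on {1..length xs} f" "f ` {1..length xs} \<subseteq> {1..length ys}"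
      "\<And>b. subseq (map f (letter_values b xs)) (letter_values b ys)" by blast
  let ?f = "f(Suc (length xs) := Suc (length ys))"
  have "subseq (map ?f (letter_values b (x # xs))) (letter_values b (y # ys))" for b
    unfolding letter_values_Cons map_append map_letter_values_upd
    using f(3) list_emb_Cons2(1) by auto
  thus ?case
    using strict_mono_on_extend[OF f(1,2)] unfolding length_Cons by blast
qed

text \<open>Entries chosen from the two lists of values are choices of letters of \<open>w\<close>,
  and \<open>w'\<close> consists of these letters. The selection \<open>s\<close> is a function of
  the letter so that the induction treats both lists together and yields one common
  \<open>f\<close>.\<close>

lemma subseq_letter_valuesE:
  assumes "\<And>b. subseq (s b) (letter_values b w)"
  shows "\<exists>w' f. subseq w' w \<and> strict_mono_on {1..length w'} f \<and> f ` {1..length w'} \<subseteq> {1..length w} \<and>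
           (\<forall>b. s b = map f (letter_values b w'))"
  using assms
proof (induction w arbitrary: s)
  case Nil
  hence "s b = []" for b
    using Nil.prems[of b] by (auto dest: list_emb_Nil2)
  thus ?case by (intro exI[of _ "[]"] exI[of _ id]) (auto intro: strict_mono_onI)
next
  case (Cons c w)
  \<comment> \<open>\<open>v\<close> records whether the first letter \<open>c\<close> is chosen;
    \<open>u\<close> comes from the rest of the word. The list of the other letter is unaffected by
    \<open>c\<close>.\<close>
  obtain u v where uv: "s c = u @ v" "subseq u (letter_values c w)" "subseq v [Suc (length w)]"
    using Cons.prems[of c] by (auto simp: letter_values_Cons elim: subseq_appendE)
  have "subseq ((s(c := u)) b) (letter_values b w)" for b
    using Cons.prems[of b] uv(2) by (auto simp: letter_values_Cons)
  from Cons.IH[of "s(c := u)", OF this] obtain w' f where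
    w': "subseq w' w" "strict_mono_on {1..length w'} f" "f ` {1..length w'} \<subseteq> {1..length w}"
      and s: "\<And>b. (s(c := u)) b = map f (letter_values b w')"
    by blast
  consider "v = []" | "v = [Suc (length w)]"
    using uv(3) by (cases v) (auto split: if_splits simp: subseq_Cons')
  thus ?case
  proof cases
    case 1
    hence "s b = map f (letter_values b w')" for b
      using s[of b] uv(1) by (auto split: if_splits)
    thus ?thesis
      using w' by (intro exI[of _ w'] exI[of _ f]) force
  next
    case 2
    let ?f = "f(Suc (length w') := Suc (length w))"
    have "s b = map ?f (letter_values b (c # w'))" for b
      unfolding letter_values_Cons map_append map_letter_values_upd
      using s[of b] uv(1) 2 by (auto split: if_splits)
    with strict_mono_on_extend[OF w'(2,3)] subseq_Cons2[OF w'(1), of c] show ?thesis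
      unfolding length_Cons by (intro exI[of _ "c # w'"] exI[of _ ?f]) (simp only: length_Cons simp_thms)
  qed
qed

lemma order_isomorphic_map_word_perm:
  assumes "strict_mono_on {1..length w} f"
  shows "order_isomorphic (map f (word_perm w)) (word_perm w)"
  using assms word_perm_in_permutations[of w]
  by (intro order_isomorphic_map) (simp add: permutations_of_set_def)

lemma subseq_word_perm:
  assumes "subseq w2 w1"
  shows "\<exists>s. subseq s (word_perm w1) \<and> order_isomorphic s (word_perm w2)"
proof -
  obtain f where f: "strict_mono_on {1..length w2} f"
      "\<And>b. subseq (map f (letter_values b w2)) (letter_values b w1)"
    using letter_values_subseq[OF assms] by blast
  have "subseq (map f (word_perm w2)) (word_perm w1)"
    unfolding word_perm_def map_append by (intro list_emb_append_mono f(2))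
  with order_isomorphic_map_word_perm[OF f(1)] show ?thesis by blast
qed

lemma subseq_word_permE:
  assumes "subseq s (word_perm w)"
  obtains w' where "subseq w' w" "order_isomorphic s (word_perm w')"
proof -
  obtain s1 s0 where s: "s = s1 @ s0" "subseq s1 (letter_values 1 w)" "subseq s0 (letter_values 0 w)"
    using assms unfolding word_perm_def by (elim subseq_appendE)
  \<comment> \<open>The two parts of \<open>s\<close>, cut at the boundary between the values of the
    ones and of the zeros, become one family indexed by the letter.\<close>
  have "subseq (if b = 1 then s1 else s0) (letter_values b w)" for b
    using s by (cases b) auto
  from subseq_letter_valuesE[of "\<lambda>b. if b = 1 then s1 else s0", OF this]
  obtain w' f where w': "subseq w' w" "strict_mono_on {1..length w'} f"
      "\<And>b. (if b = 1 then s1 else s0) = map f (letter_values b w')"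
    by blast
  have "s = map f (word_perm w')"
    using w'(3)[of 1] w'(3)[of 0] s(1) by (simp add: word_perm_def)
  thus thesis
    using that w'(1) order_isomorphic_map_word_perm[OF w'(2)] by blast
qed

section \<open>Circular containment and the characterisation\<close>

lemma circ_containsE:
  assumes "circ_contains \<sigma> \<pi>"
  obtains m s where "subseq s \<sigma>" "order_isomorphic s (rotate m \<pi>)"
proof -
  obtain k s where s: "subseq s (rotate k \<sigma>)" "order_isomorphic s \<pi>"
    using assms by (auto simp: circ_contains_def circ_def)
  let ?k = "k mod length \<sigma>"
  obtain s1 s2 where s12: "s = s1 @ s2" "subseq s1 (drop ?k \<sigma>)" "subseq s2 (take ?k \<sigma>)"
    using s(1) unfolding rotate_drop_take by (elim subseq_appendE)
  \<comment> \<open>Undoing the rotation of the large permutation swaps the two parts of the chosen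
    subsequence, which rotates the pattern instead.\<close>
  have "subseq (s2 @ s1) (take ?k \<sigma> @ drop ?k \<sigma>)"
    by (intro list_emb_append_mono s12)
  moreover have "s2 @ s1 = rotate (length s1) s"
    by (simp add: s12(1) rotate_append)
  ultimately show thesis
    unfolding append_take_drop_id using that order_isomorphic_rotate[OF s(2)] by metis
qed

theorem theorem5p10:
  fixes w1 :: "bit list" and \<tau> :: "nat list" and k :: nat
  assumes "w1 \<noteq> []" and "hd w1 = 0" and "num_runs w1 \<ge> 3"
    and "k \<ge> 1" and "\<tau> \<in> permutations_of_set {1..k}"
  shows "circ_contains (G w1) \<tau> \<longleftrightarrow>
    (\<exists>w2. w2 \<noteq> [] \<and> hd w2 = 0 \<and> (subseq w2 w1 \<or> subseq (compl_word w2) w1) \<and>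
          circ \<tau> = circ (G w2))"
proof
  assume "circ_contains (G w1) \<tau>"
  then obtain m s where s: "subseq s (word_perm w1)" "order_isomorphic s (rotate m \<tau>)"
    by (auto simp: G_eq_word_perm[OF assms(2)] elim: circ_containsE)
  from s(1) obtain w where w: "subseq w w1" "order_isomorphic s (word_perm w)"
    by (rule subseq_word_permE)
  have rot: "rotate m \<tau> \<in> permutations_of_set {1..k}"
    using assms(5) by (simp add: permutations_of_set_def)
  \<comment> \<open>Both sides are permutations order-isomorphic to \<open>s\<close>, hence
    equal.\<close>
  have eq: "rotate m \<tau> = word_perm w"
    using order_isomorphic_trans[OF order_isomorphic_sym[OF s(2)] w(2)] rot
      word_perm_in_permutations
    by (rule order_isomorphic_permutations_eq)
  hence circ: "circ \<tau> = circ (word_perm w)"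
    by (metis circ_rotate)
  have ne: "w \<noteq> []"
    using eq assms(4,5) by (auto simp: word_perm_def permutations_of_set_def)
  show "\<exists>w2. w2 \<noteq> [] \<and> hd w2 = 0 \<and> (subseq w2 w1 \<or> subseq (compl_word w2) w1) \<and>
          circ \<tau> = circ (G w2)"
  proof (cases "hd w = 0")
    case True
    thus ?thesis
      using ne w(1) circ G_eq_word_perm by metis
  next
    \<comment> \<open>A word starting with 1 is replaced by its complement, whose circular
      permutation is the same and whose own complement is \<open>w\<close>.\<close>
    case False
    hence hd: "hd (compl_word w) = 0"
      using ne by (cases w) (auto simp: compl_word_def)
    have "compl_word (compl_word w) = w"
      by (simp add: compl_word_def comp_def map_idI)
    moreover have "compl_word w \<noteq> []"
      using ne by (simp add: compl_word_def)
    moreover have "circ \<tau> = circ (G (compl_word w))"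
      using circ by (simp add: G_eq_word_perm[OF hd] circ_word_perm_compl)
    ultimately show ?thesis
      using hd w(1) by metis
  qed
next
  assume "\<exists>w2. w2 \<noteq> [] \<and> hd w2 = 0 \<and> (subseq w2 w1 \<or> subseq (compl_word w2) w1) \<and>
          circ \<tau> = circ (G w2)"
  then obtain w2 where w2: "hd w2 = 0" "subseq w2 w1 \<or> subseq (compl_word w2) w1"
      "circ \<tau> = circ (G w2)" by blast
  \<comment> \<open>\<open>w\<close> is \<open>w2\<close> or its complement, whichever is a
    subsequence of \<open>w1\<close>.\<close>
  obtain w where w: "subseq w w1" "circ \<tau> = circ (word_perm w)"
    using w2 by (metis G_eq_word_perm circ_word_perm_compl)
  have "circ_contains (word_perm w1) (word_perm w)"
    using subseq_word_perm[OF w(1)] self_in_circ unfolding circ_contains_def by blast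
  thus "circ_contains (G w1) \<tau>"
    unfolding G_eq_word_perm[OF assms(2)] using circ_contains_cong w(2) by metis
qed

end
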